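(* Let $\mathcal V$ be the set of vertically unbounded (connected) two-step rules and $\mathcal A$ the set of aperiodic two-step rules. Then $$|\mathcal V|=19328\qquad\text{and}\qquad|\mathcal V\cap\mathcal A|=19285.$$ Let $G_2$ be the group comprising the identity and the element $\sigma$ which swaps east and west steps. Then $$N_{G_2}(\mathcal V)=9744\qquad\text{and}\qquad N_{G_2}(\mathcal V\cap\mathcal A)=9722.$$
   Context: The four step types on $\mathbb Z^2$ are east $(1,0)$, north $(0,1)$, west $(-1,0)$ and south $(0,-1)$, abbreviated $e,n,w,s$. A two-step rule is a map $R:\{e,n,w,s\}^2\to\{0,1\}$, where $R(i,j)=1$ means that a step of type $i$ may be immediately followed by a step of type $j$. Its transfer matrix $T$ is the $4\times4$ matrix with $T_{ij}=R(i,j)$, rows and columns ordered $e,n,w,s$. The rule is connected if for all $i,j$ there is $k\ge1$ with $(T^k)_{ij}>0$; it is aperiodic if there is a single $k\ge1$ with $(T^k)_{ij}>0$ for all $i,j$. A rule is north-bound if in every walk obeying it there is always a north step between each pair of south steps; equivalently, there is no $k\ge1$ with $((I_nTI_n)^k)_{ss}>0$, where $I_\theta$ denotes the $4\times4$ identity matrix with its $\theta$-th diagonal entry replaced by $0$. It is south-bound if there is always a south step between each pair of north steps; equivalently, there is no $k\ge1$ with $((I_sTI_s)^k)_{nn}>0$. A rule is vertically unbounded if it is neither north-bound nor south-bound; $\mathcal V$ is the set of connected rules with this property. A permutation $\pi$ of $\{e,n,w,s\}$ acts on rules by $(\pi\cdot R)(\pi(i),\pi(j))=R(i,j)$. For a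 group $G$ acting on a set $X$ of rules, $N_G(X)$ denotes the number of orbits. *)

theory Defs
  imports "HOL-Analysis.Finite_Cartesian_Product" "HOL-Algebra.Group_Action"
begin

datatype step = East | North | West | South

instance step :: finite
proof
  have "(UNIV :: step set) = {East, North, West, South}"
    by (auto intro: step.exhaust)
  then show "finite (UNIV :: step set)"
    by (metis finite.emptyI finite.insertI)
qed

(* R i j means that a step of type i may be immediately followed by a step of type j. *)
type_synonym rule = "step \<Rightarrow> step \<Rightarrow> bool"

definition transfer_matrix :: "rule \<Rightarrow> nat ^ step ^ step"
  where "transfer_matrix R = (\<chi> i j. of_bool (R i j))"

(* The operation ^ on the vector type is componentwise, hence a separate matrix power. *)
primrec mat_power :: "'a::semiring_1 ^ 'n ^ 'n \<Rightarrow> nat \<Rightarrow> 'a ^ 'n ^ 'n"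
  where
    "mat_power A 0 = mat 1"
  | "mat_power A (Suc k) = A ** mat_power A k"

definition connected_rule :: "rule \<Rightarrow> bool"
  where "connected_rule R \<longleftrightarrow> (\<forall>i j. \<exists>k\<ge>1. mat_power (transfer_matrix R) k $ i $ j > 0)"

definition aperiodic_rule :: "rule \<Rightarrow> bool"
  where "aperiodic_rule R \<longleftrightarrow> (\<exists>k\<ge>1. \<forall>i j. mat_power (transfer_matrix R) k $ i $ j > 0)"

(* In every (finite) walk obeying R there is an a-step strictly between any two b-steps. *)
definition always_between :: "rule \<Rightarrow> step \<Rightarrow> step \<Rightarrow> bool"
  where "always_between R a b \<longleftrightarrow>
    (\<forall>w. successively R w \<longrightarrow>
      (\<forall>p q. p < q \<and> q < length w \<and> w ! p = b \<and> w ! q = b \<longrightarrow>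
        (\<exists>m. p < m \<and> m < q \<and> w ! m = a)))"

definition north_bound :: "rule \<Rightarrow> bool"
  where "north_bound R \<longleftrightarrow> always_between R North South"

definition south_bound :: "rule \<Rightarrow> bool"
  where "south_bound R \<longleftrightarrow> always_between R South North"

definition vertically_unbounded :: "rule \<Rightarrow> bool"
  where "vertically_unbounded R \<longleftrightarrow> \<not> north_bound R \<and> \<not> south_bound R"

definition vertically_unbounded_rules :: "rule set"
  where "vertically_unbounded_rules = {R. connected_rule R \<and> vertically_unbounded R}"

definition aperiodic_rules :: "rule set"
  where "aperiodic_rules = {R. aperiodic_rule R}"

(* For bijective p this is the unique rule with permute_rule p R (p i) (p j) = R i j. *)
definition permute_rule :: "(step \<Rightarrow> step) \<Rightarrow> rule \<Rightarrow> rule"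
  where "permute_rule p R = (\<lambda>i j. R (inv_into UNIV p i) (inv_into UNIV p j))"

definition swap_EW :: "step \<Rightarrow> step"
  where "swap_EW = id(East := West, West := East)"

definition G2 :: "(step \<Rightarrow> step) monoid"
  where "G2 = (BijGroup UNIV)\<lparr>carrier := {id, swap_EW}\<rparr>"

definition num_orbits :: "(step \<Rightarrow> step) monoid \<Rightarrow> rule set \<Rightarrow> nat"
  where "num_orbits G X = card (orbits G X permute_rule)"


lemma permute_rule_apply: "bij p \<Longrightarrow> permute_rule p R (p i) (p j) = R i j"
  by (simp add: permute_rule_def bij_is_inj)

lemma swap_EW_involution [simp]: "swap_EW (swap_EW i) = i"
  by (simp add: swap_EW_def)

lemma bij_swap_EW: "bij swap_EW"
  by (rule involuntory_imp_bij) simp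

lemma subgroup_G2: "subgroup {id, swap_EW} (BijGroup UNIV)"
proof -
  interpret group "BijGroup (UNIV :: step set)" by (rule group_BijGroup)
  have swap: "swap_EW \<in> Bij UNIV" and id: "id \<in> Bij (UNIV :: step set)"
    using bij_swap_EW by (auto simp: Bij_def)
  have mult: "p \<otimes>\<^bsub>BijGroup UNIV\<^esub> q = p \<circ> q"
    if "p \<in> Bij UNIV" "q \<in> Bij UNIV" for p q :: "step \<Rightarrow> step"
    using that by (simp add: BijGroup_def compose_def comp_def fun_eq_iff)
  have closed: "p \<otimes>\<^bsub>BijGroup UNIV\<^esub> q \<in> {id, swap_EW}"
    if "p \<in> {id, swap_EW}" "q \<in> {id, swap_EW}" for p q
  proof -
    have "p \<otimes>\<^bsub>BijGroup UNIV\<^esub> q = p \<circ> q"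
      using that swap id by (intro mult) auto
    moreover have "swap_EW \<circ> swap_EW = id"
      by (simp add: fun_eq_iff)
    ultimately show ?thesis
      using that by auto
  qed
  have "inv_into UNIV swap_EW = swap_EW"
    by (rule inv_unique_comp) (auto simp: fun_eq_iff)
  then have invs: "m_inv (BijGroup UNIV) p \<in> {id, swap_EW}" if "p \<in> {id, swap_EW}" for p
    using that swap id by (auto simp: inv_BijGroup)
  have "{id, swap_EW} \<subseteq> carrier (BijGroup UNIV)"
    using swap id by (simp add: BijGroup_def)
  then show ?thesis
    using closed invs by (intro subgroupI) auto
qed

lemma group_G2: "group G2"
  unfolding G2_def by (rule subgroup.subgroup_is_group[OF subgroup_G2 group_BijGroup])

lemma permute_rule_comp:
  "bij p \<Longrightarrow> bij q \<Longrightarrow> permute_rule (p \<circ> q) R = permute_rule p (permute_rule q R)"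
  by (simp add: permute_rule_def o_inv_distrib)

lemma group_action_G2: "group_action G2 UNIV permute_rule"
proof -
  have bij: "bij p" if "p \<in> carrier G2" for p
    using that bij_swap_EW by (auto simp: G2_def)
  have bij_act: "bij (permute_rule p)" if "bij p" for p
  proof (rule o_bij)
    show "permute_rule (inv_into UNIV p) \<circ> permute_rule p = id"
      using that
      by (auto simp: fun_eq_iff permute_rule_def inv_inv_eq bij_is_inj)
    show "permute_rule p \<circ> permute_rule (inv_into UNIV p) = id"
      using that
      by (auto simp: fun_eq_iff permute_rule_def inv_inv_eq bij_is_surj surj_f_inv_f)
  qed
  have "permute_rule \<in> hom G2 (BijGroup UNIV)"
  proof (rule homI)
    fix p assume p: "p \<in> carrier G2"
    then show "permute_rule p \<in> carrier (BijGroup UNIV)"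
      using bij_act[OF bij[OF p]] by (simp add: BijGroup_def Bij_def)
  next
    fix p q assume pq: "p \<in> carrier G2" "q \<in> carrier G2"
    have mult: "p \<otimes>\<^bsub>G2\<^esub> q = p \<circ> q"
      using bij[OF pq(1)] bij[OF pq(2)]
      by (simp add: G2_def BijGroup_def Bij_def compose_def fun_eq_iff)
    show "permute_rule (p \<otimes>\<^bsub>G2\<^esub> q)
        = permute_rule p \<otimes>\<^bsub>BijGroup UNIV\<^esub> permute_rule q"
      using bij_act[OF bij[OF pq(1)]] bij_act[OF bij[OF pq(2)]]
        permute_rule_comp[OF bij[OF pq(1)] bij[OF pq(2)]]
      unfolding mult by (simp add: BijGroup_def Bij_def compose_def fun_eq_iff)
  qed
  then show ?thesis
    by (intro group_action.intro group_hom.intro group_hom_axioms.intro group_G2 group_BijGroup)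
qed


lemma mat_power_pos_iff:
  fixes A :: "nat ^ 'n ^ 'n"
  shows "mat_power A k $ i $ j > 0 \<longleftrightarrow> (i, j) \<in> {(a, b). A $ a $ b > 0} ^^ k"
proof (induction k arbitrary: i)
  case 0
  show ?case by (simp add: mat_def)
next
  case (Suc k)
  have "mat_power A (Suc k) $ i $ j > 0 \<longleftrightarrow>
      (\<exists>l. A $ i $ l > 0 \<and> mat_power A k $ l $ j > 0)"
    by (auto simp: matrix_matrix_mult_def neq0_conv[symmetric] simp del: neq0_conv)
  also have "\<dots> \<longleftrightarrow> (i, j) \<in> {(a, b). A $ a $ b > 0} ^^ Suc k"
    unfolding Suc.IH relpow.simps relpow_commute[symmetric] by (simp add: relcomp_unfold)
  finally show ?case .
qed

definition punctured_id :: "step \<Rightarrow> nat ^ step ^ step"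
  where "punctured_id a = (\<chi> i j. of_bool (i = j \<and> i \<noteq> a))"

lemma punctured_transfer_matrix:
  "(punctured_id a ** transfer_matrix R ** punctured_id a) $ i $ j
    = of_bool (R i j \<and> i \<noteq> a \<and> j \<noteq> a)"
proof -
  have *: "(punctured_id a ** transfer_matrix R) $ i $ l = of_bool (R i l \<and> i \<noteq> a)" for l
  proof -
    have "(punctured_id a ** transfer_matrix R) $ i $ l
        = (\<Sum>k\<in>UNIV. if k = i then of_bool (R i l \<and> i \<noteq> a) else 0)"
      unfolding matrix_matrix_mult_def punctured_id_def transfer_matrix_def
      by (simp only: vec_lambda_beta, intro sum.cong) auto
    then show ?thesis by simp
  qed
  have "(punctured_id a ** transfer_matrix R ** punctured_id a) $ i $ j
      = (\<Sum>l\<in>UNIV. (punctured_id a ** transfer_matrix R) $ i $ l * punctured_id a $ l $ j)"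
    by (simp add: matrix_matrix_mult_def)
  also have "\<dots> = (\<Sum>l\<in>UNIV. if l = j then of_bool (R i j \<and> i \<noteq> a \<and> j \<noteq> a) else 0)"
    unfolding * by (intro sum.cong) (auto simp: punctured_id_def)
  finally show ?thesis by simp
qed

lemma always_between_iff_matrix:
  assumes "a \<noteq> b"
  shows "always_between R a b \<longleftrightarrow>
    \<not> (\<exists>k\<ge>1. mat_power (punctured_id a ** transfer_matrix R ** punctured_id a) k $ b $ b > 0)"
    (is "_ \<longleftrightarrow> \<not> ?M")
proof -
  let ?r = "{(i, j). R i j \<and> i \<noteq> a \<and> j \<noteq> a}"
  have M: "?M \<longleftrightarrow> (\<exists>k\<ge>1. \<exists>f. f 0 = b \<and> f k = b \<and> (\<forall>i<k. (f i, f (Suc i)) \<in> ?r))"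
    unfolding mat_power_pos_iff punctured_transfer_matrix by (simp add: relpow_fun_conv)
  show ?thesis
  proof
    assume ab: "always_between R a b"
    show "\<not> ?M"
    proof
      assume ?M
      then obtain k f where f: "k \<ge> 1" "f 0 = b" "f k = b"
        "\<And>i. i < k \<Longrightarrow> (f i, f (Suc i)) \<in> ?r"
        unfolding M by blast
      let ?w = "map f [0..<Suc k]"
      have w: "length ?w = Suc k" "\<And>i. i \<le> k \<Longrightarrow> ?w ! i = f i"
        by (auto simp del: upt_Suc)
      have "successively R ?w"
        unfolding successively_conv_nth using f(4) w by (simp del: upt_Suc)
      moreover have "0 < k \<and> k < length ?w \<and> ?w ! 0 = b \<and> ?w ! k = b"
        using f w by (simp del: upt_Suc)
      ultimately obtain m where "0 < m" "m < k" "?w ! m = a"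
        using ab unfolding always_between_def by blast
      then show False using w(2)[of m] f(4)[of m] by auto
    qed
  next
    assume nM: "\<not> ?M"
    show "always_between R a b"
      unfolding always_between_def
    proof (intro allI impI, rule ccontr)
      fix w p q
      assume w: "successively R w"
        and pq: "p < q \<and> q < length w \<and> w ! p = b \<and> w ! q = b"
        and no: "\<not> (\<exists>m. p < m \<and> m < q \<and> w ! m = a)"
      have ne: "w ! m \<noteq> a" if "p \<le> m" "m \<le> q" for m
        using that no pq assms by (metis le_neq_implies_less)
      have "?M" unfolding M
      proof (intro exI[of _ "q - p"] exI[of _ "\<lambda>i. w ! (p + i)"] conjI allI impI)
        fix i assume "i < q - p"
        then show "(w ! (p + i), w ! (p + Suc i)) \<in> ?r"
          using w pq ne[of "p + i"] ne[of "p + Suc i"]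
          by (auto simp: successively_conv_nth)
      qed (use pq in auto)
      with nM show False ..
    qed
  qed
qed

lemma north_bound_iff_matrix:
  "north_bound R \<longleftrightarrow> \<not> (\<exists>k\<ge>1. mat_power
     (punctured_id North ** transfer_matrix R ** punctured_id North) k $ South $ South > 0)"
  unfolding north_bound_def by (rule always_between_iff_matrix) simp

lemma south_bound_iff_matrix:
  "south_bound R \<longleftrightarrow> \<not> (\<exists>k\<ge>1. mat_power
     (punctured_id South ** transfer_matrix R ** punctured_id South) k $ North $ North > 0)"
  unfolding south_bound_def by (rule always_between_iff_matrix) simp

end

theory Submission
  imports Defs
begin

text \<open>
  Both \<^const>\<open>connected_rule\<close> and \<^const>\<open>vertically_unbounded\<close> are conditions on the digraph of
  a rule: every proper nonempty set of steps has an arc leaving it, and there are a cycle through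
  north avoiding south and a cycle through south avoiding north. A loop at east or west affects
  neither condition, and a loop at north or at south is itself one of the two required cycles. A
  strongly connected loopless digraph therefore extends to \<open>4 * a * b\<close> rules of \<open>\<V>\<close>, where \<open>a\<close> is \<open>2\<close> if
  it already has a cycle through north avoiding south and \<open>1\<close> otherwise, and \<open>b\<close> is the same for
  south. Adding these numbers over all \<open>2^12\<close> loopless digraphs gives the cardinality of \<open>\<V>\<close>
  (lemmas \<open>card_vertically_unbounded\<close> and \<open>sum_loop_choices\<close>).

  The periodic rules of \<open>\<V>\<close> are few. If a connected rule has closed walks of lengths \<open>k\<close> and
  \<open>k + 1\<close> at one vertex, then it has closed walks of all large lengths there and is aperiodic. So a
  periodic rule has no loop, and, since on four vertices a \<open>3\<close>-cycle meets every \<open>2\<close>-cycle and every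
  \<open>4\<close>-cycle, it cannot have a \<open>3\<close>-cycle together with a \<open>2\<close>-cycle or a \<open>4\<close>-cycle. Without
  \<open>3\<close>-cycles, a loopless rule in \<open>\<V>\<close> is bipartite; without \<open>2\<close>- and \<open>4\<close>-cycles, it runs
  cyclically through the classes north/south, east, west, in one of the two orders. Conversely such
  a colouring forces periodicity (lemma \<open>not_aperiodic_make_rule\<close>). There are 43 such rules.

  For the orbits, the swap of east and west is an involution, so that twice the number of orbits is
  the number of rules plus the number of rules fixed by the swap (lemma \<open>num_orbits_G2\<close>). The fixed
  rules are counted by the same two sums restricted to the digraphs with this symmetry; the factor
  \<open>4\<close> becomes \<open>2\<close>, because the loops at east and west must be present or absent together.
\<close>

section \<open>Walks, connectedness and aperiodicity\<close>

definition arc_rel :: "rule \<Rightarrow> step rel"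
  where "arc_rel R = {(i, j). R i j}"

lemma transfer_power_pos_iff:
  "mat_power (transfer_matrix R) k $ i $ j > 0 \<longleftrightarrow> (i, j) \<in> arc_rel R ^^ k"
  by (simp add: mat_power_pos_iff transfer_matrix_def arc_rel_def)

text \<open>
  If every set has a way out, then so does the set of vertices reachable from \<open>i\<close>, unless it
  contains everything. As reachability here asks for at least one step, that set is nonempty
  because of the cut around \<open>i\<close> itself; this needs a second vertex. Sets are written as
  predicates so that quantification over them can later be unfolded into truth values.
\<close>
lemma all_trancl_iff_cuts:
  fixes r :: "'a rel"
  assumes "\<And>i. \<exists>j. j \<noteq> (i :: 'a)"
  shows "(\<forall>i j. (i, j) \<in> r\<^sup>+) \<longleftrightarrow>
    (\<forall>S. (\<exists>i. S i) \<longrightarrow> (\<exists>i. \<not> S i) \<longrightarrow> (\<exists>i j. S i \<and> \<not> S j \<and> (i, j) \<in> r))"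
proof (intro iffI allI impI)
  fix S :: "'a \<Rightarrow> bool"
  assume all: "\<forall>i j. (i, j) \<in> r\<^sup>+" and "\<exists>i. S i" "\<exists>i. \<not> S i"
  then obtain i j where ij: "S i" "\<not> S j" by blast
  show "\<exists>i j. S i \<and> \<not> S j \<and> (i, j) \<in> r"
  proof (rule ccontr)
    assume closed: "\<not> ?thesis"
    have "(i, j) \<in> r\<^sup>+" using all by blast
    then have "S j"
      by (induction rule: trancl_induct) (use closed ij in blast)+
    with ij show False by blast
  qed
next
  fix i j
  assume cut: "\<forall>S. (\<exists>i. S i) \<longrightarrow> (\<exists>i. \<not> S i) \<longrightarrow> (\<exists>i j. S i \<and> \<not> S j \<and> (i, j) \<in> r)"
  have "\<exists>k. (i, k) \<in> r"
    using cut[rule_format, of "\<lambda>k. k = i"] assms[of i] by blast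
  then have "\<exists>k. (i, k) \<in> r\<^sup>+" by blast
  moreover have "\<not> (\<exists>k l. (i, k) \<in> r\<^sup>+ \<and> (i, l) \<notin> r\<^sup>+ \<and> (k, l) \<in> r)"
    by (blast intro: trancl_into_trancl)
  ultimately show "(i, j) \<in> r\<^sup>+"
    using cut[rule_format, of "\<lambda>k. (i, k) \<in> r\<^sup>+"] by blast
qed

lemma connected_rule_iff_trancl: "connected_rule R \<longleftrightarrow> (\<forall>i j. (i, j) \<in> (arc_rel R)\<^sup>+)"
  unfolding connected_rule_def transfer_power_pos_iff trancl_power by (simp add: Suc_le_eq)

lemma connected_rule_iff_cuts:
  "connected_rule R \<longleftrightarrow>
    (\<forall>S. (\<exists>i. S i) \<longrightarrow> (\<exists>i. \<not> S i) \<longrightarrow> (\<exists>i j. S i \<and> \<not> S j \<and> R i j))"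
proof -
  have "\<exists>j. j \<noteq> i" for i :: step by (metis step.distinct(1))
  from all_trancl_iff_cuts[OF this] show ?thesis
    unfolding connected_rule_iff_trancl by (simp add: arc_rel_def)
qed

text \<open>
  Once \<open>a\<close> is removed, only east and west are available between two visits of \<open>b\<close>, so a closed
  walk at \<open>b\<close> can be shortened to one of five cycles of length at most three.
\<close>
lemma always_between_iff_cycle:
  assumes ab: "{a, b} = {North, South}"
  shows "always_between R a b \<longleftrightarrow>
    \<not> (R b b \<or> R b East \<and> R East b \<or> R b West \<and> R West b \<or>
      R b East \<and> R East West \<and> R West b \<or> R b West \<and> R West East \<and> R East b)"
    (is "_ \<longleftrightarrow> \<not> ?cycle")
proof -
  let ?r = "{(i, j). R i j \<and> i \<noteq> a \<and> j \<noteq> a}"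
  have ne: "a \<noteq> b" "a \<noteq> East" "a \<noteq> West" "b \<noteq> East" "b \<noteq> West"
    using ab by (auto simp: doubleton_eq_iff)
  have steps: "v = a \<or> v = b \<or> v = East \<or> v = West" for v
    using ab by (cases v) (auto simp: doubleton_eq_iff)
  have "(b, b) \<in> ?r\<^sup>+ \<longleftrightarrow> ?cycle"
  proof
    \<comment> \<open>Invariant for walks read backwards from \<open>b\<close>: the shortest ways from each vertex to \<open>b\<close>.\<close>
    let ?to = "\<lambda>v. (v = b \<longrightarrow> ?cycle) \<and>
      (v = East \<longrightarrow> R East b \<or> R East West \<and> R West b) \<and>
      (v = West \<longrightarrow> R West b \<or> R West East \<and> R East b)"
    have "?to v" if "(v, b) \<in> ?r\<^sup>+" for v
      using that
    proof (induction rule: converse_trancl_induct)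
      case (base v)
      then show ?case using steps[of v] ne by auto
    next
      case (step v u)
      then show ?case using steps[of v] steps[of u] ne by auto
    qed
    then show "(b, b) \<in> ?r\<^sup>+ \<Longrightarrow> ?cycle" by blast
  next
    \<comment> \<open>An opaque name for the closure keeps the search for walks first-order.\<close>
    define reach where "reach i j \<longleftrightarrow> (i, j) \<in> ?r\<^sup>+" for i j
    have arc: "reach i j" if "R i j" "i \<noteq> a" "j \<noteq> a" for i j
      using that by (auto simp: reach_def)
    have arc_step: "reach i k" if "R i j" "i \<noteq> a" "j \<noteq> a" "reach j k" for i j k
      using that unfolding reach_def by (intro trancl_into_trancl2[of i j]) auto
    assume ?cycle
    then have "reach b b"
      using ne by (elim disjE conjE) (metis arc arc_step)+
    then show "(b, b) \<in> ?r\<^sup>+" by (simp only: reach_def)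
  qed
  moreover have "always_between R a b \<longleftrightarrow> (b, b) \<notin> ?r\<^sup>+"
    unfolding always_between_iff_matrix[OF ne(1)] mat_power_pos_iff punctured_transfer_matrix
      trancl_power by (simp add: Suc_le_eq)
  ultimately show ?thesis by blast
qed

lemma closed_walk_repeat: "(v, v) \<in> r ^^ k \<Longrightarrow> (v, v) \<in> r ^^ (k * m)"
proof (induction m)
  case (Suc m)
  then have "(v, v) \<in> r ^^ k O r ^^ (k * m)" by blast
  then show ?case by (simp only: mult_Suc_right relpow_add)
qed simp

text \<open>
  This is the Frobenius coin problem for \<open>k\<close> and \<open>k + 1\<close>: divide \<open>m\<close> by \<open>k\<close>; as the quotient is at
  least \<open>k\<close>, it exceeds the remainder, and of the quotient many closed walks of length \<open>k\<close> as many as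
  the remainder says can be made longer by one.
\<close>
lemma closed_walks_of_all_large_lengths:
  assumes "(v, v) \<in> r ^^ k" "(v, v) \<in> r ^^ Suc k" "0 < k" "k * k \<le> m"
  shows "(v, v) \<in> r ^^ m"
proof -
  define s where "s = m mod k"
  have "s < k" "k \<le> m div k"
    using assms(3,4) by (auto simp: s_def less_eq_div_iff_mult_less_eq)
  then obtain t where t: "m div k = s + t"
    by (metis le_Suc_ex less_imp_le order_trans)
  have "m = k * (s + t) + s"
    using mult_div_mod_eq[of k m] by (simp only: s_def t)
  then have m: "m = k * t + Suc k * s"
    by (simp add: algebra_simps)
  show ?thesis
    unfolding m relpow_add
    using closed_walk_repeat[OF assms(1), of t] closed_walk_repeat[OF assms(2), of s]
    by blast
qed

lemma all_walks_of_one_length: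
  fixes r :: "('a :: finite) rel"
  assumes conn: "\<And>i j. (i, j) \<in> r\<^sup>+"
    and closed: "(v, v) \<in> r ^^ k" "(v, v) \<in> r ^^ Suc k" "0 < k"
  shows "\<exists>m\<ge>1. \<forall>i j. (i, j) \<in> r ^^ m"
proof -
  have "\<forall>i. \<exists>n. (i, v) \<in> r ^^ n" "\<forall>j. \<exists>n. (v, j) \<in> r ^^ n"
    using conn by (metis trancl_power)+
  then obtain p q where p: "\<And>i. (i, v) \<in> r ^^ p i" and q: "\<And>j. (v, j) \<in> r ^^ q j"
    by metis
  \<comment> \<open>Long enough to walk from any \<open>i\<close> to \<open>v\<close> and from \<open>v\<close> to any \<open>j\<close>, with at least \<open>k * k\<close> steps
    left to be spent at \<open>v\<close>.\<close>
  define m where "m = (\<Sum>i\<in>UNIV. p i) + (\<Sum>j\<in>UNIV. q j) + k * k + 1"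
  have "(i, j) \<in> r ^^ m" for i j
  proof -
    have "p i \<le> (\<Sum>i\<in>UNIV. p i)" "q j \<le> (\<Sum>j\<in>UNIV. q j)"
      by (auto intro: member_le_sum)
    then have "m = p i + (m - p i - q j) + q j" "k * k \<le> m - p i - q j"
      by (auto simp: m_def)
    moreover have "(i, j) \<in> r ^^ (p i + (m - p i - q j) + q j)"
      unfolding relpow_add
      using p[of i] q[of j] closed_walks_of_all_large_lengths[OF closed calculation(2)]
      by blast
    ultimately show ?thesis by simp
  qed
  moreover have "1 \<le> m" by (simp add: m_def)
  ultimately show ?thesis by blast
qed

lemma aperiodic_if_consecutive_closed_walks:
  assumes "connected_rule R" "(v, v) \<in> arc_rel R ^^ k" "(v, v) \<in> arc_rel R ^^ Suc k" "0 < k"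
  shows "aperiodic_rule R"
  using all_walks_of_one_length[of "arc_rel R", OF _ assms(2-4)] assms(1)
  by (simp add: aperiodic_rule_def transfer_power_pos_iff connected_rule_iff_trancl)

lemma aperiodic_if_loop:
  assumes "connected_rule R" "R v v"
  shows "aperiodic_rule R"
  using aperiodic_if_consecutive_closed_walks[OF assms(1), of v 1] assms(2)
  by (auto simp: arc_rel_def)

text \<open>
  Every step advances the colour by one modulo \<open>d\<close>, so all walks of one length from a given vertex
  end in a single colour. Walks of one length between all pairs would make all colours equal, but
  the two ends of an arc differ in colour.
\<close>
lemma not_aperiodic_if_cyclic_colouring:
  fixes c :: "step \<Rightarrow> nat"
  assumes colour: "\<And>i j. R i j \<Longrightarrow> c j mod d = Suc (c i) mod d" and d: "2 \<le> d"
  shows "\<not> aperiodic_rule R"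
proof
  assume "aperiodic_rule R"
  then obtain m where m: "1 \<le> m" "\<And>i j. (i, j) \<in> arc_rel R ^^ m"
    by (auto simp: aperiodic_rule_def transfer_power_pos_iff)
  have walk: "c j mod d = (c i + k) mod d" if "(i, j) \<in> arc_rel R ^^ k" for i j k
    using that
  proof (induction k arbitrary: j)
    case (Suc k)
    then obtain l where "(i, l) \<in> arc_rel R ^^ k" "R l j"
      by (auto simp: arc_rel_def)
    then show ?case using Suc.IH[of l] colour[of l j] by (metis add_Suc_right mod_Suc_eq)
  qed simp
  obtain i j where ij: "R i j"
    using m(1) m(2)[of East East] by (cases m) (auto simp: arc_rel_def)
  have "Suc (c i) mod d = c i mod d"
    using colour[OF ij] walk[OF m(2)[of i i]] walk[OF m(2)[of i j]] by simp
  then show False using d by (simp add: mod_Suc split: if_splits)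
qed

lemma UNIV_step: "UNIV = {East, North, West, South}"
  by (auto intro: step.exhaust)

lemma length_distinct_steps: "distinct xs \<Longrightarrow> length xs \<le> 4" for xs :: "step list"
  using card_mono[OF finite subset_UNIV, of "set xs"]
  by (simp only: distinct_card) (simp add: UNIV_step)

lemma closed_walk_2: "R a b \<Longrightarrow> R b a \<Longrightarrow> (a, a) \<in> arc_rel R ^^ 2"
  and closed_walk_3: "R a b \<Longrightarrow> R b c \<Longrightarrow> R c a \<Longrightarrow> (a, a) \<in> arc_rel R ^^ 3"
  and closed_walk_4: "R a b \<Longrightarrow> R b c \<Longrightarrow> R c d \<Longrightarrow> R d a \<Longrightarrow> (a, a) \<in> arc_rel R ^^ 4"
  by (simp add: arc_rel_def numeral_eq_Suc relcomp_unfold, blast)+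

text \<open>
  Two vertices and three vertices cannot be disjoint among four steps, so the two cycles share a
  vertex, which then has closed walks of the consecutive lengths \<open>2\<close> and \<open>3\<close>.
\<close>
lemma aperiodic_if_cycles_of_lengths_2_3:
  assumes "connected_rule R"
    and "x \<noteq> y" "R x y" "R y x"
    and "distinct [a, b, c]" "R a b" "R b c" "R c a"
  shows "aperiodic_rule R"
proof -
  have two: "(x, x) \<in> arc_rel R ^^ 2" "(y, y) \<in> arc_rel R ^^ 2"
    using assms(3,4) closed_walk_2 by blast+
  have three: "(i, i) \<in> arc_rel R ^^ 3" if "i \<in> {a, b, c}" for i
    using that assms(6-8) closed_walk_3 by (metis insertE singletonD)
  have "x \<in> {a, b, c} \<or> y \<in> {a, b, c}"
  proof (rule ccontr)
    assume "\<not> ?thesis"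
    then have "distinct [x, y, a, b, c]" using assms(2,5) by simp
    from length_distinct_steps[OF this] show False by simp
  qed
  then obtain v where "(v, v) \<in> arc_rel R ^^ 2" "(v, v) \<in> arc_rel R ^^ 3"
    using two three by blast
  then show ?thesis
    by (intro aperiodic_if_consecutive_closed_walks[OF assms(1), of v 2]) simp_all
qed

lemma aperiodic_if_cycles_of_lengths_3_4:
  assumes "connected_rule R"
    and "distinct [x, y, z, u]" "R x y" "R y z" "R z u" "R u x"
    and "R a b" "R b c" "R c a"
  shows "aperiodic_rule R"
proof -
  have three: "(a, a) \<in> arc_rel R ^^ 3"
    by (rule closed_walk_3) fact+
  have four: "(i, i) \<in> arc_rel R ^^ 4" if "i \<in> {x, y, z, u}" for i
    using that assms(3-6) closed_walk_4 by (metis insertE singletonD)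
  have "a \<in> {x, y, z, u}"
  proof (rule ccontr)
    assume "\<not> ?thesis"
    then have "distinct [a, x, y, z, u]" using assms(2) by simp
    from length_distinct_steps[OF this] show False by simp
  qed
  then show ?thesis
    using three four by (intro aperiodic_if_consecutive_closed_walks[OF assms(1), of a 3]) simp_all
qed

section \<open>Rules as tuples of truth values\<close>

text \<open>
  A rule is split into its loops and its arcs between distinct steps. The component named \<open>xy\<close> says
  whether \<open>y\<close> may follow \<open>x\<close>.
\<close>
type_synonym loops = "bool \<times> bool \<times> bool \<times> bool"
type_synonym arcs = "bool \<times> bool \<times> bool \<times> bool \<times> bool \<times> bool
  \<times> bool \<times> bool \<times> bool \<times> bool \<times> bool \<times> bool"

fun make_rule :: "loops \<Rightarrow> arcs \<Rightarrow> rule"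
  where "make_rule (ee, nn, ww, ss) (en, ew, es, ne, nw, ns, we, wn, ws, se, sn, sw) =
    case_step (case_step ee en ew es) (case_step ne nn nw ns)
      (case_step we wn ww ws) (case_step se sn sw ss)"

lemma bij_make_rule: "bij (\<lambda>(L, D). make_rule L D)"
proof (rule o_bij)
  let ?cells = "\<lambda>R :: rule. ((R East East, R North North, R West West, R South South),
    (R East North, R East West, R East South, R North East, R North West, R North South,
     R West East, R West North, R West South, R South East, R South North, R South West))"
  show "?cells \<circ> (\<lambda>(L, D). make_rule L D) = id"
    by (simp add: fun_eq_iff split_paired_all)
  show "(\<lambda>(L, D). make_rule L D) \<circ> ?cells = id"
    by (auto simp: fun_eq_iff split: step.split)
qed

lemma make_rule_cases:
  obtains L D where "R = make_rule L D"
  using bij_make_rule by (metis bij_pointE case_prod_beta)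

lemma make_rule_eq_iff: "make_rule L D = make_rule L' D' \<longleftrightarrow> L = L' \<and> D = D'"
  using injD[OF bij_is_inj[OF bij_make_rule], of "(L, D)" "(L', D')"] by auto

lemma ex_step: "(\<exists>i. P i) \<longleftrightarrow> P East \<or> P North \<or> P West \<or> P South" for P :: "step \<Rightarrow> bool"
  by (metis step.exhaust)

lemma all_step_predicates: "(\<forall>S. P S) \<longleftrightarrow> (\<forall>e n w s. P (case_step e n w s))"
proof -
  have "S = case_step (S East) (S North) (S West) (S South)" for S :: "step \<Rightarrow> 'a"
    by (auto simp: fun_eq_iff split: step.splits)
  then show ?thesis by metis
qed

text \<open>
  Strong connectedness by cuts, with one clause for each of the 14 proper nonempty sets of steps: the four singletons, their
  complements, and the six pairs.
\<close>
fun strong :: "arcs \<Rightarrow> bool"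
  where "strong (en, ew, es, ne, nw, ns, we, wn, ws, se, sn, sw) \<longleftrightarrow>
    (en \<or> ew \<or> es) \<and> (ne \<or> nw \<or> ns) \<and> (we \<or> wn \<or> ws) \<and> (se \<or> sn \<or> sw) \<and>
    (ne \<or> we \<or> se) \<and> (en \<or> wn \<or> sn) \<and> (ew \<or> nw \<or> sw) \<and> (es \<or> ns \<or> ws) \<and>
    (ew \<or> es \<or> nw \<or> ns) \<and> (we \<or> wn \<or> se \<or> sn) \<and>
    (en \<or> es \<or> wn \<or> ws) \<and> (ne \<or> nw \<or> se \<or> sw) \<and>
    (en \<or> ew \<or> sn \<or> sw) \<and> (ne \<or> ns \<or> we \<or> ws)"

lemma connected_make_rule: "connected_rule (make_rule L D) \<longleftrightarrow> strong D"
  unfolding connected_rule_iff_cuts all_step_predicates ex_step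
  by (cases L; cases D rule: strong.cases)
    (simp only: make_rule.simps step.case all_bool_eq simp_thms strong.simps conj_ac disj_ac)

text \<open>The cycles found in \<open>always_between_iff_cycle\<close> other than the loop.\<close>
fun north_cycle :: "arcs \<Rightarrow> bool"
  where "north_cycle (en, ew, es, ne, nw, ns, we, wn, ws, se, sn, sw) \<longleftrightarrow>
    ne \<and> en \<or> nw \<and> wn \<or> ne \<and> ew \<and> wn \<or> nw \<and> we \<and> en"

fun south_cycle :: "arcs \<Rightarrow> bool"
  where "south_cycle (en, ew, es, ne, nw, ns, we, wn, ws, se, sn, sw) \<longleftrightarrow>
    se \<and> es \<or> sw \<and> ws \<or> se \<and> ew \<and> ws \<or> sw \<and> we \<and> es"

lemma unbounded_make_rule:
  "vertically_unbounded (make_rule (ee, nn, ww, ss) D) \<longleftrightarrow>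
    (nn \<or> north_cycle D) \<and> (ss \<or> south_cycle D)"
  unfolding vertically_unbounded_def north_bound_def south_bound_def
  by (cases D rule: strong.cases) (auto simp: always_between_iff_cycle insert_commute)

lemma vertically_unbounded_make_rule:
  "make_rule (ee, nn, ww, ss) D \<in> vertically_unbounded_rules \<longleftrightarrow>
     strong D \<and> (nn \<or> north_cycle D) \<and> (ss \<or> south_cycle D)"
  by (simp only: vertically_unbounded_rules_def mem_Collect_eq connected_make_rule
      unbounded_make_rule)

section \<open>The periodic rules\<close>

text \<open>
  A clause for each partition into two colour classes without arcs inside a class: north and south
  together, east alone, west alone, east and north together, east and south together. The two
  remaining partitions have north or south alone in a class; then every cycle passes through that
  step, so that the cycle required through the opposite one cannot avoid it.
\<close>
fun two_coloured :: "arcs \<Rightarrow> bool"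
  where "two_coloured (en, ew, es, ne, nw, ns, we, wn, ws, se, sn, sw) \<longleftrightarrow>
    \<not> (ew \<or> we \<or> ns \<or> sn) \<or> \<not> (nw \<or> wn \<or> ns \<or> sn \<or> ws \<or> sw) \<or>
    \<not> (en \<or> ne \<or> ns \<or> sn \<or> es \<or> se) \<or> \<not> (ne \<or> en \<or> sw \<or> ws) \<or> \<not> (nw \<or> wn \<or> se \<or> es)"

text \<open>
  In a vertically unbounded rule whose cycle lengths are multiples of three, north and south each
  lie on a 3-cycle with east and west, and so share a colour; the clauses are the two cyclic
  orders in which east and west can follow.
\<close>
fun three_coloured :: "arcs \<Rightarrow> bool"
  where "three_coloured (en, ew, es, ne, nw, ns, we, wn, ws, se, sn, sw) \<longleftrightarrow>
    \<not> (ns \<or> sn \<or> en \<or> es \<or> we \<or> nw \<or> sw) \<or> \<not> (ns \<or> sn \<or> wn \<or> ws \<or> ew \<or> ne \<or> se)"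

lemma two_coloured_not_aperiodic:
  assumes "two_coloured D"
  shows "\<not> aperiodic_rule (make_rule (False, False, False, False) D)" (is "\<not> aperiodic_rule ?R")
proof -
  \<comment> \<open>The colourings below list the colours of east, north, west and south in this order.\<close>
  have *: ?thesis if "\<forall>i j. ?R i j \<longrightarrow> c j mod 2 = Suc (c i) mod 2" for c
    using that by (intro not_aperiodic_if_cyclic_colouring[of _ c 2]) auto
  obtain en ew es ne nw ns we wn ws se sn sw
    where D: "D = (en, ew, es, ne, nw, ns, we, wn, ws, se, sn, sw)"
    by (cases D rule: strong.cases)
  from assms consider "\<not> (ew \<or> we \<or> ns \<or> sn)" | "\<not> (nw \<or> wn \<or> ns \<or> sn \<or> ws \<or> sw)"
    | "\<not> (en \<or> ne \<or> ns \<or> sn \<or> es \<or> se)" | "\<not> (ne \<or> en \<or> sw \<or> ws)" | "\<not> (nw \<or> wn \<or> se \<or> es)"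
    unfolding D two_coloured.simps by blast
  then show ?thesis
  proof cases
    case 1
    then show ?thesis
      by (intro *[of "case_step 0 1 0 1"]) (auto simp: D split: step.split)
  next
    case 2
    then show ?thesis
      by (intro *[of "case_step 0 1 1 1"]) (auto simp: D split: step.split)
  next
    case 3
    then show ?thesis
      by (intro *[of "case_step 1 1 0 1"]) (auto simp: D split: step.split)
  next
    case 4
    then show ?thesis
      by (intro *[of "case_step 0 0 1 1"]) (auto simp: D split: step.split)
  next
    case 5
    then show ?thesis
      by (intro *[of "case_step 1 0 0 1"]) (auto simp: D split: step.split)
  qed
qed

lemma three_coloured_not_aperiodic:
  assumes "three_coloured D"
  shows "\<not> aperiodic_rule (make_rule (False, False, False, False) D)" (is "\<not> aperiodic_rule ?R")
proof -
  \<comment> \<open>North and south get colour \<open>0\<close>, and their successor, east or west, gets colour \<open>1\<close>.\<close>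
  have *: ?thesis if "\<forall>i j. ?R i j \<longrightarrow> c j mod 3 = Suc (c i) mod 3" for c
    using that by (intro not_aperiodic_if_cyclic_colouring[of _ c 3]) auto
  obtain en ew es ne nw ns we wn ws se sn sw
    where D: "D = (en, ew, es, ne, nw, ns, we, wn, ws, se, sn, sw)"
    by (cases D rule: strong.cases)
  from assms consider "\<not> (ns \<or> sn \<or> en \<or> es \<or> we \<or> nw \<or> sw)"
    | "\<not> (ns \<or> sn \<or> wn \<or> ws \<or> ew \<or> ne \<or> se)"
    unfolding D three_coloured.simps by blast
  then show ?thesis
  proof cases
    case 1
    then show ?thesis
      by (intro *[of "case_step 1 0 2 0"]) (auto simp: D split: step.split)
  next
    case 2
    then show ?thesis
      by (intro *[of "case_step 2 0 1 0"]) (auto simp: D split: step.split)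
  qed
qed

text \<open>
  A strongly connected digraph without closed walks of odd length is bipartite, and on four vertices
  without loops an odd closed walk contains a 3-cycle. The cycles through north and south rule out
  the two partitions missing from \<^const>\<open>two_coloured\<close>. Since only finitely many truth values are
  involved, this special case is a propositional tautology; the existential quantifiers unfold to
  a disjunction over all triples of steps.
\<close>
lemma two_coloured_if_no_3_cycle:
  assumes "strong D" "north_cycle D" "south_cycle D"
    and "\<not> (\<exists>a b c. distinct [a, b, c] \<and> make_rule L D a b \<and> make_rule L D b c \<and> make_rule L D c a)"
  shows "two_coloured D"
  using assms by (cases L; cases D rule: strong.cases)
    (simp only: make_rule.simps step.case ex_step distinct.simps list.set insert_iff empty_iff
      step.distinct simp_thms strong.simps north_cycle.simps south_cycle.simps two_coloured.simps
      three_coloured.simps, argo)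

text \<open>
  Without 2-cycles, the cycles through north and through south are both 3-cycles using east
  and west, in the same direction since otherwise east and west would form a 2-cycle. Any arc
  that does not fit the colouring then closes a 2-cycle or a 4-cycle.
\<close>
lemma three_coloured_if_no_2_or_4_cycle:
  assumes "north_cycle D" "south_cycle D"
    and "\<not> (\<exists>a b. a \<noteq> b \<and> make_rule L D a b \<and> make_rule L D b a)"
    and "\<not> (\<exists>a b c d. distinct [a, b, c, d] \<and>
      make_rule L D a b \<and> make_rule L D b c \<and> make_rule L D c d \<and> make_rule L D d a)"
  shows "three_coloured D"
  using assms by (cases L; cases D rule: strong.cases)
    (simp only: make_rule.simps step.case ex_step distinct.simps list.set insert_iff empty_iff
      step.distinct simp_thms strong.simps north_cycle.simps south_cycle.simps two_coloured.simps
      three_coloured.simps, argo)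

lemma not_aperiodic_make_rule:
  assumes "strong D" "north_cycle D" "south_cycle D"
  shows "\<not> aperiodic_rule (make_rule (False, False, False, False) D) \<longleftrightarrow>
    two_coloured D \<or> three_coloured D"
proof
  let ?R = "make_rule (False, False, False, False) D"
  assume periodic: "\<not> aperiodic_rule ?R"
  have conn: "connected_rule ?R" using assms(1) by (simp only: connected_make_rule)
  show "two_coloured D \<or> three_coloured D"
  proof (rule ccontr)
    assume no: "\<not> ?thesis"
    then obtain a b c where three: "distinct [a, b, c]" "?R a b" "?R b c" "?R c a"
      using two_coloured_if_no_3_cycle[OF assms] by blast
    have "\<not> (\<exists>x y. x \<noteq> y \<and> ?R x y \<and> ?R y x)"
      using aperiodic_if_cycles_of_lengths_2_3[OF conn _ _ _ three] periodic by blast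
    moreover have "\<not> (\<exists>x y z u. distinct [x, y, z, u] \<and> ?R x y \<and> ?R y z \<and> ?R z u \<and> ?R u x)"
      using aperiodic_if_cycles_of_lengths_3_4[OF conn _ _ _ _ _ three(2-4)] periodic by blast
    ultimately show False
      using three_coloured_if_no_2_or_4_cycle[OF assms(2,3)] no by blast
  qed
qed (use two_coloured_not_aperiodic three_coloured_not_aperiodic in blast)

definition periodic_arcs :: "arcs \<Rightarrow> bool"
  where "periodic_arcs D \<longleftrightarrow>
    (two_coloured D \<or> three_coloured D) \<and> strong D \<and> north_cycle D \<and> south_cycle D"

lemma periodic_make_rule:
  "make_rule L D \<in> vertically_unbounded_rules - aperiodic_rules \<longleftrightarrow>
     L = (False, False, False, False) \<and> periodic_arcs D"
proof -
  obtain ee nn ww ss where L: "L = (ee, nn, ww, ss)" by (cases L)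
  show ?thesis
  proof (cases "ee \<or> nn \<or> ww \<or> ss")
    case True
    obtain v where v: "make_rule L D v v"
      using True
      by (cases D rule: strong.cases)
        (auto simp: L intro: that[of East] that[of North] that[of West] that[of South])
    have "make_rule L D \<in> vertically_unbounded_rules \<Longrightarrow> aperiodic_rule (make_rule L D)"
      using aperiodic_if_loop[of "make_rule L D" v] v by (simp add: vertically_unbounded_rules_def)
    then show ?thesis using True by (auto simp: L aperiodic_rules_def)
  next
    case False
    then have L: "L = (False, False, False, False)" using L by simp
    show ?thesis
      using not_aperiodic_make_rule[of D] unfolding L
      by (auto simp: vertically_unbounded_make_rule periodic_arcs_def aperiodic_rules_def
          simp del: make_rule.simps)
  qed
qed

section \<open>Orbits under the swap of east and west\<close>

text \<open>
  Give each fixed point weight two and every other point weight one: then every orbit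
  \<open>{x, f x}\<close> has total weight two.
\<close>
lemma card_orbits_of_involution:
  assumes "finite X" and inv: "\<And>x. x \<in> X \<Longrightarrow> f x \<in> X" "\<And>x. x \<in> X \<Longrightarrow> f (f x) = x"
  shows "2 * card ((\<lambda>x. {x, f x}) ` X) = card X + card {x \<in> X. f x = x}"
proof -
  let ?O = "(\<lambda>x. {x, f x}) ` X"
  have two: "(\<Sum>x | x \<in> X \<and> {x, f x} = A. 1 + of_bool (f x = x)) = (2 :: nat)"
    if "A \<in> ?O" for A
  proof -
    from that obtain y where y: "y \<in> X" "A = {y, f y}" by blast
    have "{x \<in> X. {x, f x} = A} = {y, f y}"
      using y inv by (auto simp: doubleton_eq_iff)
    then show ?thesis using y inv(2)[of y] by (cases "f y = y") auto
  qed
  have "card X + card {x \<in> X. f x = x} = (\<Sum>x\<in>X. 1 + of_bool (f x = x))"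
    using \<open>finite X\<close> by (subst sum.distrib) (simp add: sum_of_bool_eq Collect_conj_eq)
  also have "\<dots> = (\<Sum>A\<in>?O. \<Sum>x | x \<in> X \<and> {x, f x} = A. 1 + of_bool (f x = x))"
    by (rule sum.image_gen) fact
  also have "\<dots> = (\<Sum>A\<in>?O. 2)"
    using two by (intro sum.cong) auto
  finally show ?thesis by simp
qed

lemma permute_swap: "permute_rule swap_EW R = (\<lambda>i j. R (swap_EW i) (swap_EW j))"
proof -
  have "inv_into UNIV swap_EW = swap_EW"
    by (rule inv_unique_comp) (auto simp: fun_eq_iff)
  then show ?thesis by (simp add: permute_rule_def)
qed

lemma num_orbits_G2:
  assumes "\<And>R. R \<in> X \<Longrightarrow> permute_rule swap_EW R \<in> X"
  shows "2 * num_orbits G2 X = card X + card {R \<in> X. permute_rule swap_EW R = R}"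
proof -
  have "permute_rule id R = R" for R
    by (simp add: permute_rule_def)
  then have "orbit G2 permute_rule R = {R, permute_rule swap_EW R}" for R
    by (simp add: orbit_def G2_def) (auto; metis)
  then have "num_orbits G2 X = card ((\<lambda>R. {R, permute_rule swap_EW R}) ` X)"
    by (auto simp: num_orbits_def orbits_def intro!: arg_cong[of _ _ card])
  then show ?thesis
    using card_orbits_of_involution[of X "permute_rule swap_EW"] assms
    by (simp add: permute_swap)
qed

fun swap_arcs :: "arcs \<Rightarrow> arcs"
  where "swap_arcs (en, ew, es, ne, nw, ns, we, wn, ws, se, sn, sw) =
    (wn, we, ws, nw, ne, ns, ew, en, es, sw, sn, se)"

lemma permute_make_rule:
  "permute_rule swap_EW (make_rule (ee, nn, ww, ss) D) = make_rule (ww, nn, ee, ss) (swap_arcs D)"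
  unfolding permute_swap
  by (cases D rule: strong.cases) (simp add: swap_EW_def fun_eq_iff split: step.split)

lemma swap_vertically_unbounded:
  assumes "R \<in> vertically_unbounded_rules"
  shows "permute_rule swap_EW R \<in> vertically_unbounded_rules"
proof -
  obtain L D where "R = make_rule L D" by (rule make_rule_cases)
  with assms show ?thesis
    by (cases L; cases D rule: strong.cases)
      (simp only: permute_make_rule vertically_unbounded_make_rule swap_arcs.simps strong.simps
        north_cycle.simps south_cycle.simps, argo)
qed

lemma periodic_swap_arcs: "periodic_arcs (swap_arcs D) \<longleftrightarrow> periodic_arcs D"
  by (cases D rule: strong.cases)
    (simp only: periodic_arcs_def swap_arcs.simps strong.simps north_cycle.simps
      south_cycle.simps two_coloured.simps three_coloured.simps, argo)

lemma swap_aperiodic: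
  assumes "R \<in> vertically_unbounded_rules \<inter> aperiodic_rules"
  shows "permute_rule swap_EW R \<in> vertically_unbounded_rules \<inter> aperiodic_rules"
proof -
  obtain L D where R: "R = make_rule L D" by (rule make_rule_cases)
  obtain ee nn ww ss where L: "L = (ee, nn, ww, ss)" by (cases L)
  have "permute_rule swap_EW R \<notin> vertically_unbounded_rules - aperiodic_rules"
    using assms periodic_make_rule[of L D] periodic_make_rule[of _ "swap_arcs D"]
    by (auto simp: R L permute_make_rule periodic_swap_arcs simp del: make_rule.simps)
  then show ?thesis using swap_vertically_unbounded assms by blast
qed

section \<open>Counting\<close>

lemma sum_UNIV_bool: "(\<Sum>b\<in>UNIV. f b) = f False + f True" for f :: "bool \<Rightarrow> nat"
  by (simp add: UNIV_bool)

lemma sum_UNIV_prod: "(\<Sum>p\<in>UNIV. f p) = (\<Sum>a\<in>UNIV. \<Sum>b\<in>UNIV. f (a, b))"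
  for f :: "'a::finite \<times> 'b::finite \<Rightarrow> nat"
  by (simp flip: UNIV_Times_UNIV add: sum.cartesian_product)

lemma sum_of_bool_single: "(\<Sum>x\<in>UNIV. of_bool (x = t \<and> Q x)) = (of_bool (Q t) :: nat)"
  for t :: "'a :: finite"
proof -
  have "(\<Sum>x\<in>UNIV. of_bool (x = t \<and> Q x)) = (\<Sum>x\<in>UNIV. if x = t then of_bool (Q t) else (0 :: nat))"
    by (rule sum.cong) auto
  then show ?thesis by simp
qed

lemma card_rules:
  "card {R. P R} = (\<Sum>D\<in>UNIV. \<Sum>L\<in>UNIV. of_bool (P (make_rule L D)))"
proof -
  have "card {R. P R} = (\<Sum>R\<in>UNIV. of_bool (P R))"
    by (simp add: sum_of_bool_eq)
  also have "\<dots> = (\<Sum>p\<in>UNIV. of_bool (P (make_rule (fst p) (snd p))))"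
    by (subst sum.reindex_bij_betw[OF bij_make_rule, symmetric]) (simp only: case_prod_beta)
  also have "\<dots> = (\<Sum>D\<in>UNIV. \<Sum>L\<in>UNIV. of_bool (P (make_rule L D)))"
    by (subst sum.swap) (simp only: sum_UNIV_prod fst_conv snd_conv)
  finally show ?thesis .
qed

text \<open>
  The number of ways to choose the loops at north and south so that the rule becomes connected and
  vertically unbounded; a loop is optional exactly where the required cycle already exists.
\<close>
definition loop_choices :: "arcs \<Rightarrow> nat"
  where "loop_choices D = (if strong D
    then (1 + of_bool (north_cycle D)) * (1 + of_bool (south_cycle D)) else 0)"

lemma card_vertically_unbounded:
  "card vertically_unbounded_rules = 4 * (\<Sum>D\<in>UNIV. loop_choices D)"
proof -
  have "(\<Sum>L\<in>UNIV. of_bool (make_rule L D \<in> vertically_unbounded_rules)) = 4 * loop_choices D"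
    for D
    by (simp add: sum_UNIV_prod sum_UNIV_bool vertically_unbounded_make_rule loop_choices_def
      del: make_rule.simps)
  then show ?thesis
    using card_rules[of "\<lambda>R. R \<in> vertically_unbounded_rules"] by (simp add: sum_distrib_left)
qed

lemma card_vertically_unbounded_fixed:
  "card {R \<in> vertically_unbounded_rules. permute_rule swap_EW R = R} =
    2 * (\<Sum>D\<in>UNIV. if swap_arcs D = D then loop_choices D else 0)"
proof -
  have "(\<Sum>L\<in>UNIV. of_bool (make_rule L D \<in> vertically_unbounded_rules \<and>
      permute_rule swap_EW (make_rule L D) = make_rule L D)) =
    2 * (if swap_arcs D = D then loop_choices D else 0)" for D
    by (simp add: sum_UNIV_prod sum_UNIV_bool vertically_unbounded_make_rule permute_make_rule
      make_rule_eq_iff loop_choices_def del: make_rule.simps)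
  then show ?thesis
    using card_rules[of "\<lambda>R. R \<in> vertically_unbounded_rules \<and> permute_rule swap_EW R = R"]
    by (simp add: sum_distrib_left)
qed

lemma card_periodic:
  "card (vertically_unbounded_rules - aperiodic_rules) = (\<Sum>D\<in>UNIV. of_bool (periodic_arcs D))"
proof -
  have "(\<Sum>L\<in>UNIV. of_bool (make_rule L D \<in> vertically_unbounded_rules - aperiodic_rules)) =
    (of_bool (periodic_arcs D) :: nat)" for D
    by (simp only: periodic_make_rule sum_of_bool_single)
  then show ?thesis
    using card_rules[of "\<lambda>R. R \<in> vertically_unbounded_rules - aperiodic_rules"]
    by (simp del: Diff_iff)
qed

lemma card_periodic_fixed:
  "card {R \<in> vertically_unbounded_rules - aperiodic_rules. permute_rule swap_EW R = R} =
    (\<Sum>D\<in>UNIV. of_bool (swap_arcs D = D \<and> periodic_arcs D))"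
proof -
  have "(\<Sum>L\<in>UNIV. of_bool (make_rule L D \<in> vertically_unbounded_rules - aperiodic_rules \<and>
      permute_rule swap_EW (make_rule L D) = make_rule L D)) =
    (of_bool (swap_arcs D = D \<and> periodic_arcs D) :: nat)" for D
    by (simp only: periodic_make_rule sum_of_bool_single conj_assoc)
      (simp add: permute_make_rule make_rule_eq_iff conj_commute del: make_rule.simps)
  then show ?thesis
    using card_rules[of "\<lambda>R. R \<in> vertically_unbounded_rules - aperiodic_rules \<and>
      permute_rule swap_EW R = R"]
    by (simp del: Diff_iff)
qed

text \<open>
  As a congruence rule this stops the simplifier at the sign of a sum, so that a sum over
  truth values is split into its two instances before its body is touched. The body is evaluated
  only when all twelve truth values are known.
\<close>
lemma sum_weak_cong: "sum f A = sum f A" ..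

text \<open>
  A conditional is simplified only in the branch taken, so testing the rarer and cheaper condition
  first spares the evaluation of the other one for most digraphs.
\<close>
lemma of_bool_conj_if: "of_bool (P \<and> Q) = (if P then of_bool Q else (0 :: nat))"
  by simp

lemma sum_loop_choices: "(\<Sum>D\<in>UNIV. loop_choices D) = 4832"
  unfolding sum_UNIV_prod loop_choices_def strong.simps north_cycle.simps south_cycle.simps
  by (simp add: sum_UNIV_bool cong: sum_weak_cong)

lemma sum_loop_choices_fixed:
  "(\<Sum>D\<in>UNIV. if swap_arcs D = D then loop_choices D else 0) = 80"
  unfolding sum_UNIV_prod loop_choices_def swap_arcs.simps prod.inject
    strong.simps north_cycle.simps south_cycle.simps
  by (simp add: sum_UNIV_bool cong: sum_weak_cong)

lemma sum_periodic_arcs: "(\<Sum>D\<in>UNIV. of_bool (periodic_arcs D)) = (43 :: nat)"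
  unfolding sum_UNIV_prod periodic_arcs_def of_bool_conj_if[of "_ \<or> _"]
    two_coloured.simps three_coloured.simps strong.simps north_cycle.simps south_cycle.simps
  by (simp add: sum_UNIV_bool cong: sum_weak_cong)

lemma sum_periodic_arcs_fixed:
  "(\<Sum>D\<in>UNIV. of_bool (swap_arcs D = D \<and> periodic_arcs D)) = (1 :: nat)"
  unfolding sum_UNIV_prod periodic_arcs_def of_bool_conj_if[of "_ = _"]
    swap_arcs.simps prod.inject
    two_coloured.simps three_coloured.simps strong.simps north_cycle.simps south_cycle.simps
  by (simp add: sum_UNIV_bool cong: sum_weak_cong)

theorem lemma8:
  shows "card vertically_unbounded_rules = 19328 \<and>
         card (vertically_unbounded_rules \<inter> aperiodic_rules) = 19285 \<and>
         num_orbits G2 vertically_unbounded_rules = 9744 \<and>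
         num_orbits G2 (vertically_unbounded_rules \<inter> aperiodic_rules) = 9722"
proof -
  let ?V = vertically_unbounded_rules and ?A = aperiodic_rules
  let ?fixed = "\<lambda>X. {R \<in> X. permute_rule swap_EW R = R}"
  have all: "card ?V = 19328" "card (?fixed ?V) = 160"
    by (simp_all add: card_vertically_unbounded card_vertically_unbounded_fixed
        sum_loop_choices sum_loop_choices_fixed)
  have periodic: "card (?V - ?A) = 43" "card (?fixed (?V - ?A)) = 1"
    by (simp_all only: card_periodic card_periodic_fixed
        sum_periodic_arcs sum_periodic_arcs_fixed)
  have "card ?V = card (?V \<inter> ?A) + card (?V - ?A)"
    by (rule card_Int_Diff) simp
  with all periodic have aperiodic: "card (?V \<inter> ?A) = 19285" by simp
  have "card (?fixed ?V) = card (?fixed ?V \<inter> ?A) + card (?fixed ?V - ?A)"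
    by (rule card_Int_Diff) simp
  moreover have "?fixed ?V \<inter> ?A = ?fixed (?V \<inter> ?A)" "?fixed ?V - ?A = ?fixed (?V - ?A)"
    by auto
  ultimately have aperiodic_fixed: "card (?fixed (?V \<inter> ?A)) = 159"
    using all periodic by simp
  have "2 * num_orbits G2 ?V = 19328 + 160"
    using num_orbits_G2[OF swap_vertically_unbounded] all by simp
  moreover have "2 * num_orbits G2 (?V \<inter> ?A) = 19285 + 159"
    using num_orbits_G2[OF swap_aperiodic] aperiodic aperiodic_fixed by simp
  ultimately show ?thesis using all aperiodic by simp
qed

end
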